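(* Let $X$ be a complex Banach space and $T\in\mathcal{B}(X)$. Then $$\sigma_{lD}(T)=\sigma_{lBF}(T)\cup \mathcal{S}(T).$$
   Context: $\mathcal{B}(X)$ is the algebra of bounded linear operators on $X$; $N(T)$ and $R(T)$ denote null space and range. An operator is upper semi-Fredholm if its range is closed and its null space is finite-dimensional. For an integer $n\ge 0$, $T_{[n]}$ is the restriction of $T$ to $R(T^n)$, viewed as a map $R(T^n)\to R(T^n)$ (so $T_{[0]}=T$). $T$ is upper semi-B-Fredholm if for some integer $n\ge0$ the space $R(T^n)$ is closed and $T_{[n]}$ is upper semi-Fredholm. $\sigma_{lBF}(T)=\{\lambda\in\mathbb{C}: T-\lambda I\text{ is not upper semi-B-Fredholm}\}$. The ascent is $a(T)=\inf\{n\ge 0: N(T^n)=N(T^{n+1})\}$ (with $\inf\emptyset=\infty$). $T$ is left Drazin invertible if $a(T)<\infty$ and $R(T^{a(T)+1})$ is closed; $\sigma_{lD}(T)=\{\lambda\in\mathbb{C}: T-\lambda I\text{ is not left Drazin invertible}\}$. $T$ has the single-valued extension property (SVEP) at $\lambda_0\in\mathbb{C}$ if for every open disc $D$ centered at $\lambda_0$ the only analytic $f:D\to X$ with $(T-\lambda)f(\lambda)=0$ for all $\lambda\in D$ is $f\equiv0$. $\mathcal{S}(T)$ is the set of $\lambda\in\mathbb{C}$ at which $T$ does not have SVEP. *)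

theory Defs
  imports "HOL-Analysis.Analysis" "HOL-Library.Extended_Nat"
begin

text \<open>
  Complex normed spaces are real normed spaces with a compatible complex scalar multiplication,
  so that the topology, norm and \<^const>\<open>has_derivative\<close> of the library apply unchanged.
\<close>

class complex_normed_vector = real_normed_vector +
  fixes scaleC :: "complex \<Rightarrow> 'a \<Rightarrow> 'a"  (infixr \<open>*\<^sub>C\<close> 75)
  assumes scaleC_add_right: "c *\<^sub>C (x + y) = c *\<^sub>C x + c *\<^sub>C y"
    and scaleC_add_left: "(c + d) *\<^sub>C x = c *\<^sub>C x + d *\<^sub>C x"
    and scaleC_scaleC: "c *\<^sub>C (d *\<^sub>C x) = (c * d) *\<^sub>C x"
    and scaleC_one: "1 *\<^sub>C x = x"
    and scaleC_of_real: "complex_of_real r *\<^sub>C x = r *\<^sub>R x"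
    and norm_scaleC: "norm (c *\<^sub>C x) = cmod c * norm x"

class complex_banach = complex_normed_vector + complete_space

subclass (in complex_banach) banach ..

instantiation complex :: complex_banach
begin

definition scaleC_complex :: "complex \<Rightarrow> complex \<Rightarrow> complex"
  where "scaleC_complex c x = c * x"

instance
  by standard (auto simp: scaleC_complex_def algebra_simps norm_mult scaleR_conv_of_real)

end

global_interpretation complex_vector:
  vector_space "scaleC :: complex \<Rightarrow> 'a \<Rightarrow> 'a::complex_normed_vector"
  defines cspan = complex_vector.span
  by unfold_locales (simp_all add: scaleC_add_right scaleC_add_left scaleC_scaleC scaleC_one)

definition bounded_clinear ::
    "('a::complex_normed_vector \<Rightarrow> 'b::complex_normed_vector) \<Rightarrow> bool"
  where "bounded_clinear T \<longleftrightarrow> bounded_linear T \<and> (\<forall>c x. T (c *\<^sub>C x) = c *\<^sub>C T x)"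

definition cfinite_dim :: "'a::complex_normed_vector set \<Rightarrow> bool"
  where "cfinite_dim M \<longleftrightarrow> (\<exists>B. finite B \<and> M = cspan B)"

definition null_space :: "('a \<Rightarrow> 'b::zero) \<Rightarrow> 'a set"
  where "null_space T = {x. T x = 0}"

definition shift_op :: "('a \<Rightarrow> 'a) \<Rightarrow> complex \<Rightarrow> 'a \<Rightarrow> 'a::complex_normed_vector"
  where "shift_op T \<mu> = (\<lambda>x. T x - \<mu> *\<^sub>C x)"

text \<open>
  Upper semi-Fredholmness of the restriction of \<open>T\<close> to an invariant subspace \<open>M\<close>, viewed as a map
  \<open>M \<rightarrow> M\<close>; accordingly its range is required to be closed relative to \<open>M\<close>.
\<close>

definition upper_semi_Fredholm_on :: "'a::complex_normed_vector set \<Rightarrow> ('a \<Rightarrow> 'a) \<Rightarrow> bool"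
  where "upper_semi_Fredholm_on M T \<longleftrightarrow>
    T ` M \<subseteq> M \<and> closedin (top_of_set M) (T ` M) \<and> cfinite_dim (M \<inter> null_space T)"

definition upper_semi_B_Fredholm :: "('a \<Rightarrow> 'a::complex_normed_vector) \<Rightarrow> bool"
  where "upper_semi_B_Fredholm T \<longleftrightarrow>
    (\<exists>n. closed (range (T ^^ n)) \<and> upper_semi_Fredholm_on (range (T ^^ n)) T)"

definition sigma_lBF :: "('a \<Rightarrow> 'a::complex_normed_vector) \<Rightarrow> complex set"
  where "sigma_lBF T = {\<mu>. \<not> upper_semi_B_Fredholm (shift_op T \<mu>)}"

text \<open>In \<^typ>\<open>enat\<close>, the infimum of the empty set is \<open>\<infinity>\<close>.\<close>

definition ascent :: "('a \<Rightarrow> 'a::zero) \<Rightarrow> enat"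
  where "ascent T = Inf {enat n | n. null_space (T ^^ n) = null_space (T ^^ (n + 1))}"

definition left_Drazin_invertible :: "('a \<Rightarrow> 'a::complex_normed_vector) \<Rightarrow> bool"
  where "left_Drazin_invertible T \<longleftrightarrow>
    ascent T < \<infinity> \<and> closed (range (T ^^ (the_enat (ascent T) + 1)))"

definition sigma_lD :: "('a \<Rightarrow> 'a::complex_normed_vector) \<Rightarrow> complex set"
  where "sigma_lD T = {\<mu>. \<not> left_Drazin_invertible (shift_op T \<mu>)}"

text \<open>
  Vector-valued counterparts of \<open>holomorphic_on\<close> and \<open>analytic_on\<close>, which the library only provides
  for complex-valued functions: the derivative at \<open>z\<close> is multiplication by a vector \<open>d\<close>.
\<close>

definition vholomorphic_on :: "(complex \<Rightarrow> 'a::complex_normed_vector) \<Rightarrow> complex set \<Rightarrow> bool"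
    (infixl \<open>vholomorphic'_on\<close> 50)
  where "f vholomorphic_on S \<longleftrightarrow>
    (\<forall>z\<in>S. \<exists>d. (f has_derivative (\<lambda>h. h *\<^sub>C d)) (at z within S))"

definition vanalytic_on :: "(complex \<Rightarrow> 'a::complex_normed_vector) \<Rightarrow> complex set \<Rightarrow> bool"
    (infixl \<open>vanalytic'_on\<close> 50)
  where "f vanalytic_on S \<longleftrightarrow> (\<forall>z\<in>S. \<exists>e>0. f vholomorphic_on ball z e)"

definition SVEP_at :: "('a \<Rightarrow> 'a::complex_normed_vector) \<Rightarrow> complex \<Rightarrow> bool"
  where "SVEP_at T z \<longleftrightarrow>
    (\<forall>r>0. \<forall>f. f vanalytic_on ball z r \<longrightarrow>
      (\<forall>\<mu>\<in>ball z r. shift_op T \<mu> (f \<mu>) = 0) \<longrightarrow>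
      (\<forall>\<mu>\<in>ball z r. f \<mu> = 0))"

definition non_SVEP_set :: "('a \<Rightarrow> 'a::complex_normed_vector) \<Rightarrow> complex set"
  where "non_SVEP_set T = {\<mu>. \<not> SVEP_at T \<mu>}"

end

theory Submission
  imports Defs "HOL-Complex_Analysis.Conformal_Mappings"
begin

text \<open>
  Write \<open>S = T - \<lambda>\<close>. If \<open>S\<close> is injective on \<open>R(S\<^sup>n)\<close> and \<open>R(S\<^sup>n\<^sup>+\<^sup>1)\<close> is closed, the open mapping
  argument applied to \<open>S\<^sup>n\<^sup>+\<^sup>1\<close> shows that \<open>S\<close> is bounded below on \<open>R(S\<^sup>n)\<close>. Hence \<open>R(S\<^sup>n)\<close> is closed too,
  which lets one move \<open>n\<close> down to the ascent, and \<open>T - \<mu>\<close> is injective for \<open>\<mu> \<noteq> \<lambda>\<close> near \<open>\<lambda>\<close>, because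
  eigenvectors of \<open>S\<close> with nonzero eigenvalue lie in \<open>R(S\<^sup>n)\<close>; with the identity theorem this gives SVEP.

  Conversely, if \<open>S\<close> is upper semi-Fredholm on \<open>R(S\<^sup>n)\<close>, all further ranges are closed, the spaces
  \<open>N(S) \<inter> R(S\<^sup>k)\<close> stabilise at \<open>N(S) \<inter> K\<close> where \<open>K = \<Inter>k. R(S\<^sup>k)\<close> is closed, and \<open>S\<close> maps \<open>K\<close> onto itself.
  A nonzero vector of \<open>N(S) \<inter> K\<close> would then have a backward orbit in \<open>K\<close> of at most exponential
  growth, whose generating power series contradicts SVEP.
\<close>

subsection \<open>Bounded preimages under operators with closed range\<close>

text \<open>The open mapping theorem for the restriction of \<open>T\<close> to \<open>M\<close> as
  a map onto \<open>T\<close> M\<open>. Baire's theorem in the closed set\<close>T \<open>M\<close>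
  gives approximate preimages of controlled norm; successive approximation makes them exact.\<close>

lemma closed_image_bounded_preimage:
  fixes T :: "'a::banach \<Rightarrow> 'b::banach"
  assumes T: "bounded_linear T" and M: "subspace M" "closed M" and TM: "closed (T ` M)"
  obtains C where "C > 0" "\<And>y. y \<in> T ` M \<Longrightarrow> \<exists>x\<in>M. T x = y \<and> norm x \<le> C * norm y"
proof -
  interpret T: bounded_linear T by (rule T)
  define N where "N = T ` M"
  have subN: "subspace N"
    unfolding N_def using M(1) T.linear_axioms by (rule linear_subspace_image[rotated])
  \<comment> \<open>The closed sets \<open>F n\<close> exhaust \<open>N\<close>, so one of them has
    interior points relative to \<open>N\<close>.\<close>
  define F where "F n = closure (T ` (M \<inter> cball 0 (real n)))" for n
  have FN: "F n \<subseteq> N" for n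
    unfolding F_def N_def by (rule closure_minimal) (use TM in auto)
  have UF: "\<Union>(range F) = N"
  proof
    show "N \<subseteq> \<Union>(range F)"
    proof
      fix y assume "y \<in> N"
      then obtain x where x: "x \<in> M" "y = T x" by (auto simp: N_def)
      obtain n where "norm x \<le> real n" using real_arch_simple by blast
      then have "y \<in> F n" unfolding F_def using x by (intro subsetD[OF closure_subset]) auto
      then show "y \<in> \<Union>(range F)" by blast
    qed
  qed (use FN in blast)
  have "\<exists>n. (top_of_set N) interior_of (F n) \<noteq> {}"
  proof (rule ccontr)
    assume "\<not> ?thesis"
    then have "(top_of_set N) interior_of \<Union>(range F) = {}"
      using TM FN
      by (intro Baire_category_alt disjI1 completely_metrizable_space_closedin
            completely_metrizable_space_euclidean)
         (auto simp: N_def F_def closed_subset)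
    then show False
      using UF interior_of_topspace[of "top_of_set N"] subspace_0[OF subN] by auto
  qed
  then obtain n y0 where "y0 \<in> (top_of_set N) interior_of (F n)" by blast
  then obtain U where U: "openin (top_of_set N) U" "y0 \<in> U" "U \<subseteq> F n"
    by (auto simp: interior_of_def)
  then obtain e where e: "e > 0" "ball y0 e \<inter> N \<subseteq> F n" and y0: "y0 \<in> N"
    by (meson openin_contains_ball openin_imp_subset subset_iff order_trans)
  \<comment> \<open>Both \<open>y0 + y\<close> and \<open>y0\<close> lie in \<open>F n\<close>;
    subtracting approximate preimages of them removes the unknown centre \<open>y0\<close> and
    doubles the radius.\<close>
  have approx: "\<exists>x\<in>M. norm x \<le> 2 * real n \<and> norm (y - T x) < d"
    if y: "y \<in> N" "norm y < e" and d: "d > 0" for y d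
  proof -
    have "y0 + y \<in> F n" "y0 \<in> F n"
      using e y y0 subspace_add[OF subN] by (auto simp: dist_norm subset_iff)
    moreover have near: "\<exists>x\<in>M. norm x \<le> n \<and> dist (T x) z < d/2" if z: "z \<in> F n" for z
    proof -
      obtain w where "w \<in> T ` (M \<inter> cball 0 (real n))" "dist w z < d/2"
        using z half_gt_zero[OF d] unfolding F_def closure_approachable by blast
      then show ?thesis by auto
    qed
    ultimately obtain a b where a: "a \<in> M" "norm a \<le> n" "dist (T a) (y0 + y) < d/2"
      and b: "b \<in> M" "norm b \<le> n" "dist (T b) y0 < d/2"
      by meson
    have "norm (y - T (a - b)) = norm ((T b - y0) - (T a - (y0 + y)))" by (simp add: T.diff algebra_simps)
    then have "norm (y - T (a - b)) < d"
      using norm_triangle_ineq4[of "T b - y0" "T a - (y0 + y)"]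
        a(3)[unfolded dist_norm] b(3)[unfolded dist_norm] by linarith
    moreover have "norm (a - b) \<le> 2 * real n"
      using norm_triangle_ineq4[of a b] a b by simp
    ultimately show ?thesis using a b M(1) subspace_diff by blast
  qed
  \<comment> \<open>A vector \<open>y\<close> is rescaled to norm \<open>e / 2\<close>, where
    preimages of norm at most \<open>2 * n\<close> are available; undoing the factor
    \<open>s = e / (2 * norm y)\<close> gives this constant. The summand 1 keeps it positive when
    \<open>n = 0\<close>.\<close>
  define C where "C = 4 * (real n + 1) / e"
  have C: "C > 0" using e by (simp add: C_def add_pos_nonneg)
  have "\<exists>x\<in>M. norm x \<le> C * norm y \<and> norm (y - T x) \<le> norm y / 2" if y: "y \<in> N" for y
  proof (cases "y = 0")
    case True
    then show ?thesis using M(1) subspace_0 by (intro bexI[of _ 0]) (auto simp: T.zero)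
  next
    case False
    define s where "s = e / (2 * norm y)"
    have s: "s > 0" "s * norm y = e / 2" using False e by (auto simp: s_def)
    have "s *\<^sub>R y \<in> N" "norm (s *\<^sub>R y) < e"
      using s e subN y by (auto simp: subspace_scale)
    then obtain x where x: "x \<in> M" "norm x \<le> 2 * real n" "norm (s *\<^sub>R y - T x) < s * norm y / 2"
      using approx[of "s *\<^sub>R y" "s * norm y / 2"] s e by auto
    have "norm (y - T (x /\<^sub>R s)) = norm (s *\<^sub>R y - T x) / s"
    proof -
      have "y - T (x /\<^sub>R s) = (s *\<^sub>R y - T x) /\<^sub>R s" using s by (simp add: T.scaleR scaleR_diff_right)
      then show ?thesis using s(1) by (simp only: norm_scaleR) (simp add: divide_inverse_commute)
    qed
    also have "\<dots> \<le> norm y / 2" using x(3) s(1) by (simp add: field_simps)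
    finally have "norm (y - T (x /\<^sub>R s)) \<le> norm y / 2" .
    moreover have "norm (x /\<^sub>R s) \<le> C * norm y"
    proof -
      have "norm (x /\<^sub>R s) = norm x / s" using s(1) by (simp add: divide_inverse_commute)
      also have "\<dots> \<le> 2 * (real n + 1) / s" using x(2) s(1) by (intro divide_right_mono) auto
      also have "\<dots> = C * norm y" using False by (simp add: s_def C_def)
      finally show ?thesis .
    qed
    ultimately show ?thesis using x(1) M(1) subspace_scale by blast
  qed
  then obtain g where g: "\<And>y. y \<in> N \<Longrightarrow> g y \<in> M" "\<And>y. y \<in> N \<Longrightarrow> norm (g y) \<le> C * norm y"
    "\<And>y. y \<in> N \<Longrightarrow> norm (y - T (g y)) \<le> norm y / 2"
    by metis
  have "\<exists>x\<in>M. T x = y \<and> norm x \<le> 2 * C * norm y" if y: "y \<in> N" for y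
  proof -
    \<comment> \<open>\<open>r k\<close> is the error left after \<open>k\<close> corrections. It at
      least halves each time, so the corrections \<open>g (r k)\<close> sum to an exact preimage at
      the cost of a factor 2.\<close>
    define r where "r k = ((\<lambda>z. z - T (g z)) ^^ k) y" for k
    have r0: "r 0 = y" and rS: "r (Suc k) = r k - T (g (r k))" for k by (auto simp: r_def)
    have rN: "r k \<in> N" for k
    proof (induction k)
      case (Suc k)
      then show ?case unfolding rS using g(1) subN by (auto simp: N_def intro!: subspace_diff)
    qed (use y r0 in simp)
    have rb: "norm (r k) \<le> norm y * (1/2) ^ k" for k
    proof (induction k)
      case (Suc k)
      then show ?case using g(3)[OF rN[of k]] unfolding rS by simp
    qed (simp add: r0)
    have gb: "norm (g (r k)) \<le> C * norm y * (1/2) ^ k" for k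
    proof -
      have "norm (g (r k)) \<le> C * norm (r k)" using g(2) rN by blast
      also have "\<dots> \<le> C * (norm y * (1/2) ^ k)" using C rb by (intro mult_left_mono) auto
      finally show ?thesis by (simp add: mult.assoc)
    qed
    have sm: "summable (\<lambda>k. C * norm y * (1/2::real) ^ k)" by (intro summable_mult summable_geometric) simp
    have sg: "summable (\<lambda>k. norm (g (r k)))"
      by (rule summable_comparison_test'[OF sm, of 0]) (use gb in auto)
    define x where "x = (\<Sum>k. g (r k))"
    have sums: "(\<lambda>k. g (r k)) sums x"
      unfolding x_def by (rule summable_sums[OF summable_norm_cancel[OF sg]])
    have "(\<Sum>k<m. g (r k)) \<in> M" for m by (intro subspace_sum[OF M(1)] g(1) rN)
    then have "x \<in> M"
      by (rule closed_sequentially[OF M(2) _ sums[unfolded sums_def]])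
    moreover have "T x = y"
    proof -
      have "r \<longlonglongrightarrow> 0"
      proof (rule Lim_null_comparison)
        show "(\<lambda>k. norm y * (1/2) ^ k) \<longlonglongrightarrow> 0"
          by (intro tendsto_mult_right_zero LIMSEQ_power_zero) simp
      qed (use rb in auto)
      then have "(\<lambda>k. r k - r (Suc k)) sums (r 0 - 0)" by (rule telescope_sums')
      then have "(\<lambda>k. T (g (r k))) sums y" by (simp add: rS r0)
      moreover have "(\<lambda>k. T (g (r k))) sums T x" by (rule T.sums[OF sums])
      ultimately show ?thesis by (rule sums_unique2[symmetric])
    qed
    moreover have "norm x \<le> 2 * C * norm y"
    proof -
      have "norm x \<le> (\<Sum>k. norm (g (r k)))" unfolding x_def by (rule summable_norm[OF sg])
      also have "\<dots> \<le> (\<Sum>k. C * norm y * (1/2) ^ k)" by (intro suminf_le gb sg sm)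
      also have "\<dots> = 2 * C * norm y"
        by (subst suminf_mult) (simp_all add: suminf_geometric)
      finally show ?thesis .
    qed
    ultimately show ?thesis by blast
  qed
  then show ?thesis using C by (intro that[of "2 * C"]) (auto simp: N_def)
qed

subsection \<open>Hahn-Banach\<close>

text \<open>Homogeneity is only demanded as an inequality for positive scalars, which is easier to
  verify for infima; \<open>sublinear_scale\<close> recovers the equality for all nonnegative
  scalars.\<close>

definition sublinear :: "('a::real_vector \<Rightarrow> real) \<Rightarrow> bool" where
  "sublinear q \<longleftrightarrow> (\<forall>x y. q (x + y) \<le> q x + q y) \<and> (\<forall>c x. c > 0 \<longrightarrow> q (c *\<^sub>R x) \<le> c * q x)"

lemma sublinear_add: "sublinear q \<Longrightarrow> q (x + y) \<le> q x + q y"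
  and sublinear_scale_le: "sublinear q \<Longrightarrow> c > 0 \<Longrightarrow> q (c *\<^sub>R x) \<le> c * q x"
  by (auto simp: sublinear_def)

lemma sublinear_zero: assumes "sublinear q" shows "q 0 = 0"
  using sublinear_add[OF assms, of 0 0] sublinear_scale_le[OF assms, of "1/2" 0] by simp

lemma sublinear_scale: assumes "sublinear q" "c \<ge> 0" shows "q (c *\<^sub>R x) = c * q x"
proof (cases "c = 0")
  case False
  then have c: "c > 0" using assms by simp
  have "q ((1/c) *\<^sub>R (c *\<^sub>R x)) \<le> 1/c * q (c *\<^sub>R x)"
    using c by (intro sublinear_scale_le assms) auto
  then have "c * q x \<le> q (c *\<^sub>R x)" using c by (simp add: field_simps)
  then show ?thesis using sublinear_scale_le[OF assms(1) c, of x] by simp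
qed (simp add: sublinear_zero assms)

lemma sublinear_neg_le: assumes "sublinear q" shows "- q (- x) \<le> q x"
  using sublinear_add[OF assms, of x "- x"] sublinear_zero[OF assms] by simp

text \<open>Pushes a sublinear \<open>q\<close> down along \<open>y\<close>: \<open>t = 0\<close>
  shows that the result lies below \<open>q\<close>, and \<open>t = 1\<close> that its value at
  \<open>- y\<close> is at most \<open>- q y\<close>.\<close>

definition shear :: "('a::real_vector \<Rightarrow> real) \<Rightarrow> 'a \<Rightarrow> 'a \<Rightarrow> real" where
  "shear q y x = (INF t\<in>{0..}. q (x + t *\<^sub>R y) - t * q y)"

lemma shear_le:
  assumes "sublinear q" "t \<ge> 0" shows "shear q y x \<le> q (x + t *\<^sub>R y) - t * q y"
  unfolding shear_def
proof (rule cINF_lower)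
  \<comment> \<open>A lower bound independent of \<open>s\<close>, so that the infimum in
    \<open>shear\<close> is a genuine one.\<close>
  have "- q (- x) \<le> q (x + s *\<^sub>R y) - s * q y" if "s \<ge> 0" for s
    using sublinear_add[OF assms(1), of "x + s *\<^sub>R y" "- x"]
      sublinear_scale[OF assms(1) that, of y] by simp
  then show "bdd_below ((\<lambda>t. q (x + t *\<^sub>R y) - t * q y) ` {0..})"
    by (intro bdd_belowI[of _ "- q (- x)"]) auto
qed (use assms in auto)

lemma shear_greatest:
  "(\<And>t. t \<ge> 0 \<Longrightarrow> b \<le> q (x + t *\<^sub>R y) - t * q y) \<Longrightarrow> b \<le> shear q y x"
  unfolding shear_def by (rule cINF_greatest) auto

text \<open>Parameters \<open>t\<close> for \<open>x\<close> and \<open>s\<close> for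
  \<open>z\<close> combine to \<open>s + t\<close> for \<open>x + z\<close>; a parameter
  \<open>t\<close> for \<open>x\<close> becomes \<open>c * t\<close> for
  \<open>c *\<^sub>R x\<close>.\<close>

lemma sublinear_shear: assumes q: "sublinear q" shows "sublinear (shear q y)"
  unfolding sublinear_def
proof (intro conjI allI impI)
  fix x z
  have "shear q y (x + z) - (q (z + s *\<^sub>R y) - s * q y) \<le> q (x + t *\<^sub>R y) - t * q y"
    if "s \<ge> 0" "t \<ge> 0" for s t
    using shear_le[OF q, of "s + t" y "x + z"] that
      sublinear_add[OF q, of "x + t *\<^sub>R y" "z + s *\<^sub>R y"]
    by (simp add: algebra_simps)
  then have "shear q y (x + z) - (q (z + s *\<^sub>R y) - s * q y) \<le> shear q y x" if "s \<ge> 0" for s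
    using that by (intro shear_greatest) auto
  then have "shear q y (x + z) - shear q y x \<le> shear q y z"
    by (intro shear_greatest) (force simp: algebra_simps)
  then show "shear q y (x + z) \<le> shear q y x + shear q y z" by simp
next
  fix c :: real and x assume c: "c > 0"
  have "shear q y (c *\<^sub>R x) / c \<le> q (x + t *\<^sub>R y) - t * q y" if "t \<ge> 0" for t
    using shear_le[OF q, of "c * t" y "c *\<^sub>R x"] that c
      sublinear_scale[OF q, of c "x + t *\<^sub>R y"]
    by (simp add: field_simps)
  then have "shear q y (c *\<^sub>R x) / c \<le> shear q y x" by (rule shear_greatest)
  then show "shear q y (c *\<^sub>R x) \<le> c * shear q y x" using c by (simp add: field_simps)
qed

text \<open>A minimal sublinear functional coincides with all its shears, hence is additive.\<close>

lemma Hahn_Banach_sublinear: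
  fixes p :: "'a::real_vector \<Rightarrow> real"
  assumes p: "sublinear p"
  obtains \<phi> where "linear \<phi>" "\<And>x. \<phi> x \<le> p x"
proof -
  define A where "A = {q. sublinear q \<and> q \<le> p}"
  \<comment> \<open>Zorn's lemma for the reversed order: the bound of a nonempty chain is its
    pointwise infimum, finite because every member lies above \<open>- p (- x)\<close> at
    \<open>x\<close>.\<close>
  have "\<exists>m\<in>A. \<forall>a\<in>A. (\<lambda>q q'. q' \<le> q) m a \<longrightarrow> a = m"
  proof (rule predicate_Zorn)
    show "partial_order_on A (relation_of (\<lambda>q q'. q' \<le> q) A)"
      by (rule partial_order_on_relation_ofI) auto
    fix C assume C: "C \<in> Chains (relation_of (\<lambda>q q'. q' \<le> q) A)"
    have CA: "q \<in> A" if "q \<in> C" for q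
      using C that by (auto simp: Chains_def relation_of_def)
    have cmp: "q \<le> q' \<or> q' \<le> q" if "q \<in> C" "q' \<in> C" for q q'
      using C that by (auto simp: Chains_def relation_of_def)
    show "\<exists>u\<in>A. \<forall>a\<in>C. u \<le> a"
    proof (cases "C = {}")
      case True
      then show ?thesis using p by (auto simp: A_def)
    next
      case False
      define u where "u x = (INF q\<in>C. q x)" for x
      have u_le: "u x \<le> q x" if "q \<in> C" for q x
        unfolding u_def
      proof (rule cINF_lower[OF bdd_belowI2[of _ "- p (- x)"] that])
        fix q assume "q \<in> C"
        then have "sublinear q" "q (- x) \<le> p (- x)" using CA by (auto simp: A_def le_fun_def)
        then show "- p (- x) \<le> q x" using sublinear_neg_le[of q x] by simp
      qed
      have u_gr: "b \<le> u x" if "\<And>q. q \<in> C \<Longrightarrow> b \<le> q x" for b x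
        unfolding u_def using False that by (rule cINF_greatest)
      have "sublinear u"
        unfolding sublinear_def
      proof (intro conjI allI impI)
        fix x y
        \<comment> \<open>The smaller of two members of the chain lies below both, so its
          subadditivity serves for the mixed pair.\<close>
        have "u (x + y) \<le> q1 x + q2 y" if q: "q1 \<in> C" "q2 \<in> C" for q1 q2
        proof -
          obtain q where "q \<in> C" "q \<le> q1" "q \<le> q2" using cmp[OF q] q by blast
          moreover have "q (x + y) \<le> q x + q y"
            using CA[OF \<open>q \<in> C\<close>] by (auto simp: A_def sublinear_add)
          ultimately show ?thesis
            using u_le[of q "x + y"] le_funD[of q q1 x] le_funD[of q q2 y] by linarith
        qed
        then have "u (x + y) - q2 y \<le> u x" if "q2 \<in> C" for q2
          using that by (intro u_gr) (auto simp: algebra_simps)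
        then have "u (x + y) - u x \<le> u y" by (intro u_gr) (force simp: algebra_simps)
        then show "u (x + y) \<le> u x + u y" by simp
      next
        fix c :: real and x assume c: "c > 0"
        have "u (c *\<^sub>R x) / c \<le> u x"
        proof (rule u_gr)
          fix q assume q: "q \<in> C"
          have "q (c *\<^sub>R x) \<le> c * q x" using CA[OF q] c by (auto simp: A_def sublinear_scale_le)
          then show "u (c *\<^sub>R x) / c \<le> q x" using u_le[OF q, of "c *\<^sub>R x"] c by (simp add: field_simps)
        qed
        then show "u (c *\<^sub>R x) \<le> c * u x" using c by (simp add: field_simps)
      qed
      moreover have "u \<le> p"
      proof -
        obtain q where "q \<in> C" using False by blast
        then show ?thesis using u_le CA by (fastforce simp: A_def le_fun_def intro: order_trans)
      qed
      ultimately show ?thesis using u_le by (intro bexI[of _ u]) (auto simp: A_def le_fun_def)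
    qed
  qed
  then obtain m where m: "sublinear m" "m \<le> p"
    and min: "\<And>q. sublinear q \<Longrightarrow> q \<le> m \<Longrightarrow> q = m"
    by (auto simp: A_def intro: order_trans)
  have shear_m: "shear m y = m" for y
    by (rule min[OF sublinear_shear[OF m(1)]])
       (use shear_le[OF m(1), of 0] in \<open>auto simp: le_fun_def\<close>)
  \<comment> \<open>With \<open>t = 1\<close>, invariance under \<open>shear\<close> reads
    \<open>m x \<le> m (x + y) - m y\<close>, the converse of subadditivity.\<close>
  have add: "m (x + y) = m x + m y" for x y
    using shear_le[OF m(1), of 1 y x] sublinear_add[OF m(1), of x y] by (simp add: shear_m)
  have neg: "m (- x) = - m x" for x
    using add[of x "- x"] sublinear_zero[OF m(1)] by simp
  have "linear m"
  proof (rule linearI)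
    show "m (c *\<^sub>R x) = c *\<^sub>R m x" for c x
      using sublinear_scale[OF m(1), of c x] sublinear_scale[OF m(1), of "- c" x] neg[of "c *\<^sub>R x"]
      by (cases "c \<ge> 0") auto
  qed (rule add)
  then show ?thesis using that m(2) by (auto simp: le_fun_def)
qed

lemma sublinear_norm: "sublinear norm"
  by (auto simp: sublinear_def norm_triangle_ineq)

text \<open>Dominating by \<open>shear norm a\<close> instead of \<open>norm\<close> forces \<phi>
  to be at most \<open>- norm a\<close> at \<open>- a\<close>, which pins down its value at
  \<open>a\<close>.\<close>

corollary norming_functional:
  fixes a :: "'a::real_normed_vector"
  obtains \<phi> where "bounded_linear \<phi>" "\<And>x. \<bar>\<phi> x\<bar> \<le> norm x" "\<phi> a = norm a"
proof -
  obtain \<phi> where lin: "linear \<phi>" and le: "\<And>x. \<phi> x \<le> shear norm a x"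
    using Hahn_Banach_sublinear[OF sublinear_shear[OF sublinear_norm]] by blast
  have le_norm: "\<phi> x \<le> norm x" for x
    using le[of x] shear_le[OF sublinear_norm, of 0 a x] by simp
  have abs: "\<bar>\<phi> x\<bar> \<le> norm x" for x
    using le_norm[of x] le_norm[of "- x"] linear_neg[OF lin, of x] by simp
  have "\<phi> (- a) \<le> - norm a"
    using le[of "- a"] shear_le[OF sublinear_norm, of 1 a "- a"] by simp
  then have "\<phi> a = norm a" using le_norm[of a] linear_neg[OF lin, of a] by simp
  moreover have "bounded_linear \<phi>"
    using lin abs by (intro bounded_linear_intro[where K = 1]) (auto simp: linear_add linear_cmul)
  ultimately show ?thesis using that abs by blast
qed

subsection \<open>Closed ranges\<close>

lemma bounded_linear_scaleC_right: "bounded_linear (\<lambda>x::'a::complex_normed_vector. c *\<^sub>C x)"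
  by (rule bounded_linear_intro[where K = "cmod c"])
     (simp_all add: scaleC_add_right norm_scaleC scaleC_scaleC mult.commute flip: scaleC_of_real)

lemma bounded_linear_scaleC_left: "bounded_linear (\<lambda>c. c *\<^sub>C (x::'a::complex_normed_vector))"
  by (rule bounded_linear_intro[where K = "norm x"])
     (simp_all add: scaleC_add_left norm_scaleC scaleC_scaleC scaleR_conv_of_real flip: scaleC_of_real)

lemma csubspace_imp_subspace:
  fixes L :: "'a::complex_normed_vector set"
  assumes "complex_vector.subspace L" shows "subspace L"
  unfolding subspace_def
  using complex_vector.subspace_0[OF assms] complex_vector.subspace_add[OF assms]
    complex_vector.subspace_scale[OF assms]
  by (simp flip: scaleC_of_real)

lemma bounded_clinear_imp_bounded_linear: "bounded_clinear T \<Longrightarrow> bounded_linear T"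
  and bounded_clinear_scaleC: "bounded_clinear T \<Longrightarrow> T (c *\<^sub>C x) = c *\<^sub>C T x"
  by (auto simp: bounded_clinear_def)

lemma bounded_linear_funpow:
  fixes T :: "'a::real_normed_vector \<Rightarrow> 'a"
  assumes "bounded_linear T" shows "bounded_linear (T ^^ n)"
  by (induction n)
     (use assms in \<open>auto simp: id_def comp_def intro: bounded_linear_ident bounded_linear_compose\<close>)

lemma bounded_clinear_funpow:
  fixes T :: "'a::complex_normed_vector \<Rightarrow> 'a"
  assumes "bounded_clinear T" shows "bounded_clinear (T ^^ n)"
proof -
  have "(T ^^ n) (c *\<^sub>C x) = c *\<^sub>C (T ^^ n) x" for c x
    by (induction n) (auto simp: bounded_clinear_scaleC[OF assms])
  then show ?thesis
    using bounded_linear_funpow assms by (auto simp: bounded_clinear_def)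
qed

lemma bounded_clinear_shift_op: assumes "bounded_clinear T" shows "bounded_clinear (shift_op T \<mu>)"
  using assms bounded_linear_scaleC_right[of \<mu>]
  by (auto simp: bounded_clinear_def shift_op_def scaleC_scaleC mult.commute
      complex_vector.scale_right_diff_distrib intro!: bounded_linear_sub)

lemma csubspace_image:
  assumes T: "bounded_clinear T" and L: "complex_vector.subspace L"
  shows "complex_vector.subspace (T ` L)"
proof -
  interpret bounded_linear T using T by (rule bounded_clinear_imp_bounded_linear)
  show ?thesis
    unfolding complex_vector.subspace_def
    using complex_vector.subspace_0[OF L] complex_vector.subspace_add[OF L]
      complex_vector.subspace_scale[OF L]
    by (force simp: zero simp flip: add bounded_clinear_scaleC[OF T])
qed

lemma csubspace_null_space:
  assumes T: "bounded_clinear T" shows "complex_vector.subspace (null_space T)"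
proof -
  interpret bounded_linear T using T by (rule bounded_clinear_imp_bounded_linear)
  show ?thesis
    by (auto simp: complex_vector.subspace_def null_space_def zero add bounded_clinear_scaleC[OF T])
qed

text \<open>If \<open>x\<close> is outside \<open>L\<close>, it has positive distance
  \<open>d\<close> from \<open>L\<close>, so the coefficient of \<open>x\<close> is bounded by the
  norm of the sum divided by \<open>d\<close>. The coefficients along a convergent sequence are
  therefore Cauchy.\<close>

lemma closed_csubspace_plus_line:
  fixes L :: "'a::complex_normed_vector set"
  assumes L: "complex_vector.subspace L" "closed L"
  shows "closed {l + c *\<^sub>C x | l c. l \<in> L}" (is "closed ?A")
proof (cases "x \<in> L")
  case True
  have "?A = L"
  proof
    show "?A \<subseteq> L" using True L(1) by (auto intro: complex_vector.subspace_add complex_vector.subspace_scale)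
    show "L \<subseteq> ?A"
    proof
      fix l assume "l \<in> L"
      then show "l \<in> ?A" by (intro CollectI exI[of _ l] exI[of _ 0]) simp
    qed
  qed
  then show ?thesis using L by simp
next
  case False
  then obtain d where d: "d > 0" "ball x d \<subseteq> - L"
    using L(2) by (metis ComplI open_Compl open_contains_ball)
  have lower: "cmod c * d \<le> norm (l + c *\<^sub>C x)" if l: "l \<in> L" for l c
  proof (cases "c = 0")
    case False
    have "(- (1/c)) *\<^sub>C l \<in> L" using L(1) l by (rule complex_vector.subspace_scale)
    then have "d \<le> norm (x - (- (1/c)) *\<^sub>C l)" using d by (force simp: dist_norm)
    then have "cmod c * d \<le> cmod c * norm (x - (- (1/c)) *\<^sub>C l)" by (intro mult_left_mono) auto
    also have "\<dots> = norm (c *\<^sub>C (x - (- (1/c)) *\<^sub>C l))" by (simp add: norm_scaleC)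
    also have "c *\<^sub>C (x - (- (1/c)) *\<^sub>C l) = l + c *\<^sub>C x"
      using False by (simp add: complex_vector.scale_right_distrib scaleC_scaleC scaleC_one add.commute)
    finally show ?thesis .
  qed simp
  show ?thesis
    unfolding closed_sequential_limits
  proof (intro allI impI, elim conjE)
    fix u y assume u: "\<forall>n. u n \<in> ?A" and lim: "u \<longlonglongrightarrow> y"
    then obtain l c where lc: "\<And>n. l n \<in> L" "\<And>n. u n = l n + c n *\<^sub>C x"
      by (auto simp: choice_iff) metis
    have "Cauchy c"
    proof (rule metric_CauchyI)
      fix e :: real assume "e > 0"
      then obtain N where N: "\<And>m n. m \<ge> N \<Longrightarrow> n \<ge> N \<Longrightarrow> dist (u m) (u n) < e * d"
        using metric_CauchyD[OF LIMSEQ_imp_Cauchy[OF lim], of "e * d"] d by auto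
      have "dist (c m) (c n) < e" if "m \<ge> N" "n \<ge> N" for m n
      proof -
        have "l m - l n \<in> L" using L(1) lc(1) by (intro complex_vector.subspace_diff)
        from lower[OF this, of "c m - c n"]
        have "cmod (c m - c n) * d \<le> norm (u m - u n)"
          by (simp add: lc(2) complex_vector.scale_left_diff_distrib algebra_simps)
        also have "\<dots> < e * d" using N[OF that] by (simp add: dist_norm)
        finally show ?thesis using d by (simp add: dist_norm)
      qed
      then show "\<exists>N. \<forall>m\<ge>N. \<forall>n\<ge>N. dist (c m) (c n) < e" by blast
    qed
    then obtain c0 where "c \<longlonglongrightarrow> c0" using Cauchy_convergent convergent_def by blast
    then have "(\<lambda>n. u n - c n *\<^sub>C x) \<longlonglongrightarrow> y - c0 *\<^sub>C x"
      by (intro tendsto_diff lim bounded_linear.tendsto[OF bounded_linear_scaleC_left])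
    then have "l \<longlonglongrightarrow> y - c0 *\<^sub>C x" by (simp add: lc(2))
    then have "y - c0 *\<^sub>C x \<in> L" using closed_sequentially[OF L(2)] lc(1) by blast
    then show "y \<in> ?A" by (intro CollectI exI[of _ "y - c0 *\<^sub>C x"] exI[of _ c0]) simp
  qed
qed

text \<open>Induction over a finite spanning set, adjoining one line at a time.\<close>

lemma closed_csubspace_plus_finite_dim:
  fixes L :: "'a::complex_normed_vector set"
  assumes L: "complex_vector.subspace L" "closed L" and F: "cfinite_dim F"
  shows "closed {l + b | l b. l \<in> L \<and> b \<in> F}"
proof -
  obtain B where "finite B" "F = cspan B" using F by (auto simp: cfinite_dim_def)
  have "closed {l + b | l b. l \<in> L \<and> b \<in> cspan B}"
    using \<open>finite B\<close>
  proof induction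
    case empty
    then show ?case using L(2) by simp
  next
    case (insert x B)
    let ?S = "{l + b | l b. l \<in> L \<and> b \<in> cspan B}"
    have "{l + b | l b. l \<in> L \<and> b \<in> cspan (insert x B)} = {s + c *\<^sub>C x | s c. s \<in> ?S}"
    proof safe
      fix l b assume "l \<in> L" "b \<in> cspan (insert x B)"
      then obtain c where "b - c *\<^sub>C x \<in> cspan B" by (auto simp: complex_vector.span_breakdown_eq)
      then show "\<exists>s c. l + b = s + c *\<^sub>C x \<and> s \<in> ?S"
        using \<open>l \<in> L\<close>
        by (intro exI[of _ "l + (b - c *\<^sub>C x)"] exI[of _ c]) auto
    next
      fix l b c assume "l \<in> L" "b \<in> cspan B"
      then show "\<exists>l' b'. l + b + c *\<^sub>C x = l' + b' \<and> l' \<in> L \<and> b' \<in> cspan (insert x B)"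
        by (intro exI[of _ l] exI[of _ "b + c *\<^sub>C x"])
           (auto simp: complex_vector.span_breakdown_eq intro: exI[of _ c])
    qed
    then show ?case
      using closed_csubspace_plus_line[of ?S x] insert.IH
        complex_vector.subspace_sums[OF L(1) complex_vector.subspace_span] by simp
  qed
  then show ?thesis using \<open>F = cspan B\<close> by simp
qed

text \<open>The vectors of \<open>M\<close> mapped into \<open>T\<close>
  L\<open>form\<close>L\<open>plus the kernel in\<close>M\<open>, a closed space because that kernel
  is finite-dimensional. Bounded preimages in\<close>M\<open>lift convergence in\<close>T
  \<open>M\<close> to convergence in \<open>M\<close>, which transfers closedness to the
  image.\<close>

lemma closed_image_of_finite_dim_kernel:
  fixes T :: "'a::complex_banach \<Rightarrow> 'b::complex_banach"
  assumes T: "bounded_clinear T"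
    and M: "complex_vector.subspace M" "closed M" "closed (T ` M)"
    and N: "cfinite_dim (M \<inter> null_space T)"
    and L: "complex_vector.subspace L" "closed L" "L \<subseteq> M"
  shows "closed (T ` L)"
proof -
  interpret bounded_linear T using T by (rule bounded_clinear_imp_bounded_linear)
  obtain C where "C > 0" and C: "\<And>y. y \<in> T ` M \<Longrightarrow> \<exists>x\<in>M. T x = y \<and> norm x \<le> C * norm y"
    by (rule closed_image_bounded_preimage[OF bounded_linear_axioms
          csubspace_imp_subspace[OF M(1)] M(2,3)]) (rule that)
  note clo = closed_csubspace_plus_finite_dim[OF L(1,2) N]
  show ?thesis
    unfolding closed_sequential_limits
  proof (intro allI impI, elim conjE)
    fix u y assume "\<forall>n. u n \<in> T ` L" and lim: "u \<longlonglongrightarrow> y"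
    then have "\<forall>n. \<exists>l. l \<in> L \<and> u n = T l" by blast
    then obtain l where l: "\<And>n. l n \<in> L" "\<And>n. u n = T (l n)" by metis
    have "u n \<in> T ` M" for n using l L(3) by auto
    then have "y \<in> T ` M" by (rule closed_sequentially[OF M(3) _ lim])
    then obtain m where m: "m \<in> M" "y = T m" by blast
    have "u n - y = T (l n - m)" for n using l m by (simp add: diff)
    moreover have "l n - m \<in> M" for n
      using l(1) L(3) m M(1) by (auto intro: complex_vector.subspace_diff)
    ultimately have "\<exists>d\<in>M. T d = u n - y \<and> norm d \<le> C * norm (u n - y)" for n
      using C by blast
    then obtain d where d: "\<And>n. d n \<in> M" "\<And>n. T (d n) = u n - y"
      "\<And>n. norm (d n) \<le> C * norm (u n - y)" by metis
    \<comment> \<open>The corrected vectors \<open>m + d n\<close> have the same images as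
      \<open>l n\<close> and converge to \<open>m\<close>, although \<open>l\<close> itself may
      diverge.\<close>
    have "d \<longlonglongrightarrow> 0"
    proof (rule Lim_null_comparison)
      show "(\<lambda>n. C * norm (u n - y)) \<longlonglongrightarrow> 0"
        using lim by (intro tendsto_mult_right_zero tendsto_norm_zero) (rule LIM_zero)
    qed (use d in auto)
    then have "(\<lambda>n. m + d n) \<longlonglongrightarrow> m + 0" by (intro tendsto_intros)
    moreover have "m + d n \<in> {a + b | a b. a \<in> L \<and> b \<in> M \<inter> null_space T}" for n
    proof -
      have "m + d n - l n \<in> M \<inter> null_space T"
        using m d l L(3) M(1)
        by (auto simp: null_space_def diff add
            intro!: complex_vector.subspace_diff complex_vector.subspace_add)
      then show ?thesis using l by (intro CollectI exI[of _ "l n"] exI[of _ "m + d n - l n"]) auto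
    qed
    ultimately have "m \<in> {a + b | a b. a \<in> L \<and> b \<in> M \<inter> null_space T}"
      using closed_sequentially[OF clo] by fastforce
    then show "y \<in> T ` L" using m by (auto simp: null_space_def add)
  qed
qed

text \<open>Closedness of \<open>range (S ^^ j)\<close> is not yet available, so bounded preimages
  are taken under \<open>S ^^ Suc j\<close> on the whole space. For such a preimage \<open>x\<close>
  of \<open>S z\<close>, injectivity identifies \<open>(S ^^ j) x\<close> with
  \<open>z\<close>.\<close>

lemma bounded_below_on_range:
  fixes S :: "'a::banach \<Rightarrow> 'a"
  assumes S: "bounded_linear S" and clo: "closed (range (S ^^ Suc j))"
    and inj: "\<And>z. z \<in> range (S ^^ j) \<Longrightarrow> S z = 0 \<Longrightarrow> z = 0"
  obtains C where "C > 0" "\<And>z. z \<in> range (S ^^ j) \<Longrightarrow> norm z \<le> C * norm (S z)"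
proof -
  interpret S: bounded_linear S by (rule S)
  interpret Sj: bounded_linear "S ^^ j" by (rule bounded_linear_funpow[OF S])
  obtain C where C: "C > 0" "\<And>y. y \<in> range (S ^^ Suc j) \<Longrightarrow> \<exists>x. (S ^^ Suc j) x = y \<and> norm x \<le> C * norm y"
    by (rule closed_image_bounded_preimage[OF bounded_linear_funpow[OF S] subspace_UNIV closed_UNIV clo]) simp
  obtain K where K: "K > 0" "\<And>x. norm ((S ^^ j) x) \<le> norm x * K" using Sj.pos_bounded by blast
  have "norm z \<le> K * C * norm (S z)" if z: "z \<in> range (S ^^ j)" for z
  proof -
    have "S z \<in> range (S ^^ Suc j)" using z by auto
    then obtain x where x: "S ((S ^^ j) x) = S z" "norm x \<le> C * norm (S z)" using C(2) by force
    have "(S ^^ j) x - z \<in> range (S ^^ j)" using z by (auto simp flip: Sj.diff)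
    then have "(S ^^ j) x - z = 0" by (rule inj) (simp add: S.diff x)
    then have "norm z \<le> norm x * K" using K(2)[of x] by simp
    also have "\<dots> \<le> C * norm (S z) * K" using x(2) K(1) by (intro mult_right_mono) auto
    finally show ?thesis by (simp add: ac_simps)
  qed
  then show ?thesis using that[of "K * C"] C(1) K(1) by auto
qed

text \<open>The image under \<open>S\<close> of a limit \<open>y\<close> of the range equals
  \<open>S w\<close> for some \<open>w\<close> in the range. Boundedness below makes the
  approximating sequence converge to \<open>w\<close>, so \<open>y = w\<close>.\<close>

lemma closed_range_descends:
  fixes S :: "'a::banach \<Rightarrow> 'a"
  assumes S: "bounded_linear S" and clo: "closed (range (S ^^ Suc j))"
    and inj: "\<And>z. z \<in> range (S ^^ j) \<Longrightarrow> S z = 0 \<Longrightarrow> z = 0"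
  shows "closed (range (S ^^ j))"
proof -
  interpret S: bounded_linear S by (rule S)
  interpret Sj: bounded_linear "S ^^ j" by (rule bounded_linear_funpow[OF S])
  obtain C where C: "C > 0" "\<And>z. z \<in> range (S ^^ j) \<Longrightarrow> norm z \<le> C * norm (S z)"
    using bounded_below_on_range[OF assms] by blast
  show ?thesis
    unfolding closed_sequential_limits
  proof (intro allI impI, elim conjE)
    fix u y assume u: "\<forall>n. u n \<in> range (S ^^ j)" and lim: "u \<longlonglongrightarrow> y"
    have "S v \<in> range (S ^^ Suc j)" if "v \<in> range (S ^^ j)" for v using that by auto
    then have "S y \<in> range (S ^^ Suc j)"
      using u by (intro closed_sequentially[OF clo _ S.tendsto[OF lim]]) blast
    then obtain w where w: "w \<in> range (S ^^ j)" "S y = S w" by auto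
    have "(\<lambda>n. u n - w) \<longlonglongrightarrow> 0"
    proof (rule Lim_null_comparison)
      have "u n - w \<in> range (S ^^ j)" for n
        by (rule subspace_diff[OF linear_subspace_image[OF Sj.linear_axioms subspace_UNIV]])
           (use u w(1) in blast)+
      then show "\<forall>\<^sub>F n in sequentially. norm (u n - w) \<le> C * norm (S (u n) - S w)"
        using C(2) by (simp flip: S.diff)
      have "(\<lambda>n. S (u n) - S w) \<longlonglongrightarrow> S y - S w" by (intro tendsto_diff S.tendsto lim tendsto_const)
      then show "(\<lambda>n. C * norm (S (u n) - S w)) \<longlonglongrightarrow> 0"
        using w(2) by (intro tendsto_mult_right_zero tendsto_norm_zero) simp
    qed
    then have "u \<longlonglongrightarrow> w" by (rule LIM_zero_cancel)
    then show "y \<in> range (S ^^ j)" using LIMSEQ_unique[OF lim] w(1) by simp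
  qed
qed

text \<open>Turns the condition behind \<open>ascent\<close> into injectivity on a range, the form
  that interacts with the closed range arguments.\<close>

lemma null_space_funpow_eq_iff:
  fixes S :: "'a::real_normed_vector \<Rightarrow> 'a"
  assumes "bounded_linear S"
  shows "null_space (S ^^ n) = null_space (S ^^ (n + 1)) \<longleftrightarrow> (\<forall>z\<in>range (S ^^ n). S z = 0 \<longrightarrow> z = 0)"
proof -
  interpret bounded_linear S by (rule assms)
  show ?thesis by (auto simp: null_space_def set_eq_iff zero)
qed

lemma range_funpow_antimono:
  fixes S :: "'a \<Rightarrow> 'a"
  assumes "m \<le> n" shows "range (S ^^ n) \<subseteq> range (S ^^ m)"
proof
  fix z assume "z \<in> range (S ^^ n)"
  then obtain x where "z = (S ^^ (m + (n - m))) x" using assms by auto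
  then show "z \<in> range (S ^^ m)" unfolding funpow_add by simp
qed

text \<open>Replaces the exact ascent by any index with injectivity. Such an \<open>n\<close> is at
  least the ascent, and closedness descends from exponent \<open>Suc n\<close> because injectivity
  on one range passes to all smaller ones.\<close>

lemma left_Drazin_invertible_iff:
  fixes S :: "'a::complex_banach \<Rightarrow> 'a"
  assumes S: "bounded_linear S"
  shows "left_Drazin_invertible S \<longleftrightarrow>
    (\<exists>n. (\<forall>z\<in>range (S ^^ n). S z = 0 \<longrightarrow> z = 0) \<and> closed (range (S ^^ Suc n)))"
proof -
  let ?inj = "\<lambda>n. \<forall>z\<in>range (S ^^ n). S z = 0 \<longrightarrow> z = 0"
  have asc: "ascent S = Inf {enat n | n. ?inj n}"
    by (simp add: ascent_def null_space_funpow_eq_iff[OF S, simplified])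
  \<comment> \<open>A nonempty infimum in \<open>enat\<close> is attained, so the ascent is itself
    an index with injectivity and the least one.\<close>
  have fin: "?inj (the_enat (ascent S)) \<and> ascent S < \<infinity> \<and> the_enat (ascent S) \<le> n" if "?inj n" for n
  proof -
    have "enat n \<in> {enat n | n. ?inj n}" using that by blast
    moreover from this have "ascent S = (LEAST e. e \<in> {enat n | n. ?inj n})"
      unfolding asc Inf_enat_def by auto
    ultimately have "ascent S \<in> {enat n | n. ?inj n}" "ascent S \<le> enat n"
      by (metis (no_types, lifting) LeastI, metis (no_types, lifting) Least_le)
    then show ?thesis by auto
  qed
  have nonempty: "\<exists>n. ?inj n" if "ascent S < \<infinity>"
    using that unfolding asc by (auto simp: Inf_enat_def split: if_splits)
  show ?thesis
  proof
    assume "left_Drazin_invertible S"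
    then show "\<exists>n. ?inj n \<and> closed (range (S ^^ Suc n))"
      using nonempty fin unfolding left_Drazin_invertible_def Suc_eq_plus1 by meson
  next
    assume "\<exists>n. ?inj n \<and> closed (range (S ^^ Suc n))"
    then obtain n where n: "?inj n" "closed (range (S ^^ Suc n))" by blast
    define p where "p = the_enat (ascent S)"
    have p: "?inj p" "ascent S < \<infinity>" "p \<le> n" using fin[OF n(1)] by (auto simp: p_def)
    have "Suc p \<le> Suc n" using p(3) by simp
    then have "closed (range (S ^^ Suc p))"
    proof (induction rule: inc_induct)
      case base
      then show ?case by (rule n(2))
    next
      case (step k)
      show ?case
      proof (rule closed_range_descends[OF S step.IH])
        fix z assume "z \<in> range (S ^^ k)" "S z = 0"
        then show "z = 0"
          using p(1) range_funpow_antimono[of p k S] step.hyps by auto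
      qed
    qed
    then show "left_Drazin_invertible S"
      using p(2) by (simp add: left_Drazin_invertible_def p_def)
  qed
qed

subsection \<open>Vector-valued holomorphic functions\<close>

lemma vholomorphic_on_imp_vanalytic_on:
  assumes "open S" "f vholomorphic_on S" shows "f vanalytic_on S"
  unfolding vanalytic_on_def
proof
  fix z assume "z \<in> S"
  then obtain e where "e > 0" "ball z e \<subseteq> S" using assms(1) by (meson open_contains_ball)
  then show "\<exists>e>0. f vholomorphic_on ball z e"
    using assms(2) unfolding vholomorphic_on_def by (meson has_derivative_subset subsetD)
qed

lemma sums_power_zero_scaleC:
  fixes x :: "nat \<Rightarrow> 'a::complex_normed_vector"
  shows "(\<lambda>k. 0 ^ k *\<^sub>C x k) sums x 0"
proof -
  have "(\<lambda>k. 0 ^ k *\<^sub>C x k) = (\<lambda>k. if k = 0 then x 0 else 0)"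
    by (auto simp: power_0_left scaleC_one)
  then show ?thesis using sums_single[of 0 "\<lambda>_. x 0"] by simp
qed

text \<open>Termwise differentiation. The radius is half of the guaranteed radius of convergence
  \<open>1 / C\<close>, which leaves a geometric factor to dominate the differentiated
  series.\<close>

lemma vholomorphic_power_series:
  fixes x :: "nat \<Rightarrow> 'a::complex_banach"
  assumes x: "\<And>k. norm (x k) \<le> C ^ k * D" and C: "C > 0"
  obtains f where "f vholomorphic_on ball \<alpha> (1 / (2 * C))"
    "\<And>\<mu>. \<mu> \<in> ball \<alpha> (1 / (2 * C)) \<Longrightarrow> (\<lambda>k. (\<mu> - \<alpha>) ^ k *\<^sub>C x k) sums f \<mu>"
proof -
  define B where "B = ball \<alpha> (1 / (2 * C))"
  \<comment> \<open>The vector multiplying \<open>h\<close> in the derivative of the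
    \<open>k\<close>-th term; for \<open>k = 0\<close> the truncated exponent is harmless since the
    factor \<open>of_nat k\<close> vanishes.\<close>
  define t where "t k \<mu> = (of_nat k * (\<mu> - \<alpha>) ^ (k - 1)) *\<^sub>C x k" for k \<mu>
  \<comment> \<open>On \<open>B\<close>, the product of \<open>(1 / (2 * C)) ^ (k - 1)\<close> and
    \<open>C ^ k\<close> is at most \<open>2 * C * (1/2) ^ k\<close> for
    \<open>k > 0\<close>.\<close>
  define b where "b k = 2 * C * D * (of_nat k * (1/2) ^ k)" for k
  have t_le: "norm (t k \<mu>) \<le> b k" if "\<mu> \<in> B" for k \<mu>
  proof (cases k)
    case (Suc j)
    have "cmod (\<mu> - \<alpha>) \<le> 1 / (2 * C)" using that by (simp add: B_def dist_norm norm_minus_commute)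
    then have "cmod (\<mu> - \<alpha>) ^ j \<le> (1 / (2 * C)) ^ j" by (intro power_mono) auto
    then have "norm (t k \<mu>) \<le> real k * (1 / (2 * C)) ^ j * (C ^ k * D)"
      unfolding t_def norm_scaleC norm_mult norm_power norm_of_nat
      using x[of k] C Suc by (intro mult_mono) auto
    also have "\<dots> = b k" using C by (simp add: b_def Suc power_divide power_mult_distrib field_simps)
    finally show ?thesis .
  qed (simp add: t_def b_def)
  have "summable (\<lambda>k. of_nat k * (1/2::real) ^ k)"
  proof -
    have "summable (\<lambda>k. of_nat (Suc k) * (1/2::real) ^ k)"
      using geometric_deriv_sums[of "1/2::real"] by (simp add: sums_iff)
    then have "summable (\<lambda>k. (1/2) * (of_nat (Suc k) * (1/2::real) ^ k))" by (rule summable_mult)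
    then show ?thesis by (subst summable_Suc_iff[symmetric]) (simp add: ac_simps)
  qed
  then have b: "summable b" unfolding b_def by (rule summable_mult)
  define d where "d \<mu> = (\<Sum>k. t k \<mu>)" for \<mu>
  have unif: "uniform_limit B (\<lambda>n \<mu>. \<Sum>k<n. t k \<mu>) d sequentially"
    unfolding d_def using t_le b by (rule Weierstrass_m_test)
  have B: "open B" "convex B" "\<alpha> \<in> B" using C by (auto simp: B_def)
  have "\<exists>f. \<forall>\<mu>\<in>B. (\<lambda>k. (\<mu> - \<alpha>) ^ k *\<^sub>C x k) sums f \<mu> \<and>
      (f has_derivative (\<lambda>h. h *\<^sub>C d \<mu>)) (at \<mu> within B)"
  proof (rule has_derivative_series[OF B(2) _ _ B(3)])
    fix k \<mu>
    have "((\<lambda>\<mu>. (\<mu> - \<alpha>) ^ k) has_derivative (\<lambda>h. of_nat k * (\<mu> - \<alpha>) ^ (k - 1) * h)) (at \<mu> within B)"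
      by (auto intro!: derivative_eq_intros simp: ac_simps)
    from bounded_linear.has_derivative[OF bounded_linear_scaleC_left this]
    show "((\<lambda>\<mu>. (\<mu> - \<alpha>) ^ k *\<^sub>C x k) has_derivative (\<lambda>h. h *\<^sub>C t k \<mu>)) (at \<mu> within B)"
      by (simp add: t_def scaleC_scaleC mult.commute)
  next
    fix e :: real assume "e > 0"
    then have "\<forall>\<^sub>F n in sequentially. \<forall>\<mu>\<in>B. dist (\<Sum>k<n. t k \<mu>) (d \<mu>) < e"
      using unif by (simp add: uniform_limit_iff)
    then show "\<forall>\<^sub>F n in sequentially. \<forall>\<mu>\<in>B. \<forall>h. norm ((\<Sum>k<n. h *\<^sub>C t k \<mu>) - h *\<^sub>C d \<mu>) \<le> e * norm h"
    proof eventually_elim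
      case (elim n)
      show ?case
      proof (intro ballI allI)
        fix \<mu> h assume "\<mu> \<in> B"
        have "norm ((\<Sum>k<n. h *\<^sub>C t k \<mu>) - h *\<^sub>C d \<mu>) = cmod h * dist (\<Sum>k<n. t k \<mu>) (d \<mu>)"
          by (simp add: dist_norm flip: norm_scaleC complex_vector.scale_sum_right
              complex_vector.scale_right_diff_distrib)
        also have "\<dots> \<le> cmod h * e" using elim \<open>\<mu> \<in> B\<close> by (intro mult_left_mono) auto
        finally show "norm ((\<Sum>k<n. h *\<^sub>C t k \<mu>) - h *\<^sub>C d \<mu>) \<le> e * norm h" by (simp add: mult.commute)
      qed
    qed
  next
    show "(\<lambda>k. (\<alpha> - \<alpha>) ^ k *\<^sub>C x k) sums x 0"
      using sums_power_zero_scaleC by simp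
  qed
  then obtain f where "\<And>\<mu>. \<mu> \<in> B \<Longrightarrow> (\<lambda>k. (\<mu> - \<alpha>) ^ k *\<^sub>C x k) sums f \<mu>"
    "\<And>\<mu>. \<mu> \<in> B \<Longrightarrow> (f has_derivative (\<lambda>h. h *\<^sub>C d \<mu>)) (at \<mu> within B)"
    by blast
  then show ?thesis unfolding B_def by (intro that[of f]) (auto simp only: vholomorphic_on_def)
qed

text \<open>A real norming functional \<phi> is the real part of the complex functional sending
  \<open>x\<close> to \<open>\<phi> x - \<i> * \<phi> (\<i> *\<^sub>C x)\<close>.\<close>

lemma separating_clinear_functional:
  fixes a :: "'a::complex_normed_vector"
  assumes "a \<noteq> 0"
  obtains \<psi> :: "'a \<Rightarrow> complex" where "bounded_clinear \<psi>" "\<psi> a \<noteq> 0"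
proof -
  obtain \<phi> where \<phi>: "bounded_linear \<phi>" "\<And>x::'a. \<bar>\<phi> x\<bar> \<le> norm x" "\<phi> a = norm a"
    using norming_functional by blast
  interpret bounded_linear \<phi> by (rule \<phi>(1))
  define \<psi> where "\<psi> x = Complex (\<phi> x) (- \<phi> (\<i> *\<^sub>C x))" for x
  have scaleC_eq: "c *\<^sub>C x = Re c *\<^sub>R x + Im c *\<^sub>R (\<i> *\<^sub>C x)" for c and x :: 'a
    by (simp add: scaleC_scaleC mult.commute flip: scaleC_of_real scaleC_add_left complex_eq)
  have \<phi>_scaleC: "\<phi> (c *\<^sub>C x) = Re c * \<phi> x + Im c * \<phi> (\<i> *\<^sub>C x)" for c x
    by (subst scaleC_eq) (simp add: add scaleR)
  have \<phi>_ii: "\<phi> (\<i> *\<^sub>C \<i> *\<^sub>C x) = - \<phi> x" for x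
    by (simp add: scaleC_scaleC neg scaleC_one)
  have scale: "\<psi> (c *\<^sub>C x) = c * \<psi> x" for c x
  proof -
    have swap: "\<i> *\<^sub>C c *\<^sub>C x = c *\<^sub>C \<i> *\<^sub>C x" by (simp add: scaleC_scaleC mult.commute)
    show ?thesis
      unfolding \<psi>_def swap \<phi>_scaleC[of c] \<phi>_ii by (simp add: complex_eq_iff)
  qed
  have "bounded_linear \<psi>"
  proof (rule bounded_linear_intro[where K = 2])
    show "\<psi> (x + y) = \<psi> x + \<psi> y" for x y
      by (simp add: \<psi>_def add scaleC_add_right complex_eq_iff)
    show "\<psi> (r *\<^sub>R x) = r *\<^sub>R \<psi> x" for r x
      using scale[of "of_real r" x] by (simp add: scaleC_of_real scaleR_conv_of_real)
    show "cmod (\<psi> x) \<le> norm x * 2" for x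
      using cmod_le[of "\<psi> x"] \<phi>(2)[of x] \<phi>(2)[of "\<i> *\<^sub>C x"] by (simp add: \<psi>_def norm_scaleC)
  qed
  moreover have "\<psi> a \<noteq> 0" using assms \<phi>(3) by (simp add: \<psi>_def complex_eq_iff)
  ultimately show ?thesis
    using that scale by (auto simp: bounded_clinear_def scaleC_complex_def)
qed

text \<open>A nonzero value would be detected by a complex functional, and composing with it reduces
  the claim to the scalar identity theorem.\<close>

lemma vanalytic_on_identity:
  fixes f :: "complex \<Rightarrow> 'a::complex_normed_vector"
  assumes f: "f vanalytic_on S" and S: "open S" "connected S"
    and U: "U \<subseteq> S" "\<xi> \<in> S" "\<xi> islimpt U" "\<And>z. z \<in> U \<Longrightarrow> f z = 0" and w: "w \<in> S"
  shows "f w = 0"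
proof (rule ccontr)
  assume "f w \<noteq> 0"
  then obtain \<psi> :: "'a \<Rightarrow> complex" where \<psi>: "bounded_clinear \<psi>" "\<psi> (f w) \<noteq> 0"
    by (rule separating_clinear_functional)
  have lin: "bounded_linear \<psi>" using \<psi>(1) by (rule bounded_clinear_imp_bounded_linear)
  have "(\<psi> \<circ> f) holomorphic_on S"
  proof (rule holomorphic_onI)
    fix z assume "z \<in> S"
    then obtain e where e: "e > 0" "f vholomorphic_on ball z e" using f by (auto simp: vanalytic_on_def)
    then have "z \<in> ball z e" by simp
    then obtain d where "(f has_derivative (\<lambda>h. h *\<^sub>C d)) (at z)"
      using e(2) unfolding vholomorphic_on_def by (metis at_within_open open_ball)
    then have "((\<lambda>z. \<psi> (f z)) has_derivative (\<lambda>h. \<psi> (h *\<^sub>C d))) (at z)"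
      by (rule bounded_linear.has_derivative[OF lin])
    then have "((\<psi> \<circ> f) has_field_derivative \<psi> d) (at z)"
      by (simp add: has_field_derivative_def bounded_clinear_scaleC[OF \<psi>(1)] scaleC_complex_def
          comp_def mult_commute_abs)
    then show "(\<psi> \<circ> f) field_differentiable (at z within S)"
      by (auto simp: field_differentiable_def intro: has_field_derivative_at_within)
  qed
  moreover have "(\<psi> \<circ> f) z = 0" if "z \<in> U" for z
    using U(4)[OF that] by (simp add: linear_simps[OF lin])
  ultimately have "(\<psi> \<circ> f) w = 0" by (rule analytic_continuation[OF _ S U(1-3) _ w])
  then show False using \<psi>(2) by simp
qed

subsection \<open>The single-valued extension property\<close>

lemma shift_op_shift_op: "shift_op T \<mu> x = shift_op T \<alpha> x - (\<mu> - \<alpha>) *\<^sub>C x"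
  by (simp add: shift_op_def complex_vector.scale_left_diff_distrib)

lemma left_Drazin_invertible_imp_SVEP_at:
  fixes T :: "'a::complex_banach \<Rightarrow> 'a"
  assumes T: "bounded_clinear T" and LD: "left_Drazin_invertible (shift_op T \<alpha>)"
  shows "SVEP_at T \<alpha>"
proof -
  define S where "S = shift_op T \<alpha>"
  have S: "bounded_clinear S" unfolding S_def by (rule bounded_clinear_shift_op[OF T])
  note Sl = bounded_clinear_imp_bounded_linear[OF S]
  obtain n where n: "\<forall>z\<in>range (S ^^ n). S z = 0 \<longrightarrow> z = 0" "closed (range (S ^^ Suc n))"
    using LD[folded S_def] unfolding left_Drazin_invertible_iff[OF Sl] by (elim exE conjE) (rule that)
  obtain C where C: "C > 0" "\<And>z. z \<in> range (S ^^ n) \<Longrightarrow> norm z \<le> C * norm (S z)"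
    using bounded_below_on_range[OF Sl n(2)] n(1) by blast
  \<comment> \<open>An eigenvector of \<open>S\<close> for \<open>\<mu> - \<alpha>\<close> is its
    own image under \<open>S ^^ n\<close> up to a nonzero factor, hence lies in the range on which
    \<open>S\<close> is bounded below. This excludes eigenvalues of modulus less than
    \<open>1 / C\<close> other than 0.\<close>
  have eigen0: "v = 0" if v: "shift_op T \<mu> v = 0" and \<mu>: "\<mu> \<noteq> \<alpha>" "dist \<alpha> \<mu> < 1 / C" for \<mu> v
  proof (rule ccontr)
    assume "v \<noteq> 0"
    have Sv: "S v = (\<mu> - \<alpha>) *\<^sub>C v" using v by (simp add: shift_op_shift_op[of T \<mu> _ \<alpha>] S_def)
    have "(S ^^ k) v = (\<mu> - \<alpha>) ^ k *\<^sub>C v" for k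
      by (induction k) (auto simp: Sv bounded_clinear_scaleC[OF S] scaleC_scaleC scaleC_one mult.commute)
    then have "(S ^^ n) ((1 / (\<mu> - \<alpha>) ^ n) *\<^sub>C v) = v"
      using \<mu> by (simp add: bounded_clinear_scaleC[OF bounded_clinear_funpow[OF S]] scaleC_scaleC scaleC_one)
    then have "v \<in> range (S ^^ n)" by (metis rangeI)
    then have "norm v \<le> C * (dist \<alpha> \<mu> * norm v)"
      using C(2)[of v] by (simp add: Sv norm_scaleC dist_norm norm_minus_commute)
    also have "\<dots> < norm v" using \<mu>(2) C(1) \<open>v \<noteq> 0\<close> by (simp add: field_simps)
    finally show False by simp
  qed
  show ?thesis
    unfolding SVEP_at_def
  proof (intro allI impI ballI)
    fix r :: real and f \<mu>
    assume r: "r > 0" and f: "f vanalytic_on ball \<alpha> r"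
      and eig: "\<forall>\<mu>\<in>ball \<alpha> r. shift_op T \<mu> (f \<mu>) = 0" and \<mu>: "\<mu> \<in> ball \<alpha> r"
    \<comment> \<open>The zeros obtained on this punctured disc accumulate at \<alpha>, so they
      propagate to the whole ball of radius \<open>r\<close>, including \<alpha> itself.\<close>
    define U where "U = ball \<alpha> (min r (1 / C)) - {\<alpha>}"
    show "f \<mu> = 0"
    proof (rule vanalytic_on_identity[OF f open_ball connected_ball _ _ _ _ \<mu>])
      show "\<alpha> islimpt U"
        unfolding U_def using r C(1) by (simp add: islimpt_ball flip: islimpt_punctured)
      fix z assume "z \<in> U"
      then have "z \<in> ball \<alpha> r" "z \<noteq> \<alpha>" "dist \<alpha> z < 1 / C" by (auto simp: U_def)
      then show "f z = 0" by (rule eigen0[OF eig[rule_format]])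
    qed (use r in \<open>auto simp: U_def\<close>)
  qed
qed

text \<open>The same index serves: \<open>range (S ^^ n)\<close> is closed by descent, and the
  kernel of \<open>S\<close> on it is trivial.\<close>

lemma left_Drazin_invertible_imp_upper_semi_B_Fredholm:
  fixes S :: "'a::complex_banach \<Rightarrow> 'a"
  assumes S: "bounded_linear S" and LD: "left_Drazin_invertible S"
  shows "upper_semi_B_Fredholm S"
proof -
  interpret bounded_linear S by (rule S)
  obtain n where n: "\<forall>z\<in>range (S ^^ n). S z = 0 \<longrightarrow> z = 0" "closed (range (S ^^ Suc n))"
    using LD unfolding left_Drazin_invertible_iff[OF S] by (elim exE conjE) (rule that)
  have "closed (range (S ^^ n))" using closed_range_descends[OF S n(2)] n(1) by blast
  moreover have img: "S ` range (S ^^ n) = range (S ^^ Suc n)" by (simp add: image_comp)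
  moreover have "0 \<in> range (S ^^ n)"
    by (rule range_eqI[of _ _ 0]) (simp add: linear_simps(3)[OF bounded_linear_funpow[OF S]])
  then have "range (S ^^ n) \<inter> null_space S = cspan {}"
    using n(1) by (auto simp: null_space_def zero)
  ultimately show ?thesis
    unfolding upper_semi_B_Fredholm_def upper_semi_Fredholm_on_def cfinite_dim_def
    using closed_subset[OF _ n(2)] range_funpow_antimono[of n "Suc n" S]
    by (metis finite.emptyI le_SucI order_refl)
qed

subsection \<open>Finite ascent from the single-valued extension property\<close>

text \<open>Pick \<open>k0\<close> of least dimension. A vector of \<open>V k0\<close> outside a
  later \<open>V k\<close> would extend a basis of \<open>V k\<close> to an independent set with
  more than \<open>dim (V k0)\<close> elements inside \<open>V k0\<close>.\<close>

lemma decreasing_csubspaces_stabilise: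
  fixes V :: "nat \<Rightarrow> 'a::complex_normed_vector set"
  assumes sub: "\<And>k. complex_vector.subspace (V k)" and dec: "decseq V"
    and fin: "cfinite_dim W" "V 0 \<subseteq> W"
  obtains k0 where "\<And>k. k \<ge> k0 \<Longrightarrow> V k = V k0"
proof -
  obtain F where F: "finite F" "W = cspan F" using fin(1) by (auto simp: cfinite_dim_def)
  obtain k0 where k0: "\<And>k. complex_vector.dim (V k0) \<le> complex_vector.dim (V k)"
    using ex_has_least_nat[of "\<lambda>_. True" _ "\<lambda>k. complex_vector.dim (V k)"] by blast
  have "V k = V k0" if "k \<ge> k0" for k
  proof
    show "V k \<subseteq> V k0" using dec that by (simp add: decseq_def)
    obtain B where B: "B \<subseteq> V k" "complex_vector.independent B" "V k \<subseteq> cspan B"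
      "card B = complex_vector.dim (V k)" by (rule complex_vector.basis_exists)
    obtain B0 where B0: "B0 \<subseteq> V k0" "complex_vector.independent B0" "V k0 \<subseteq> cspan B0"
      "card B0 = complex_vector.dim (V k0)" by (rule complex_vector.basis_exists)
    have "V k0 \<subseteq> cspan F" using dec fin(2) F(2) by (auto simp: decseq_def)
    \<comment> \<open>An infinite basis would have the default cardinality 0; finiteness gives the
      comparison of dimensions its meaning.\<close>
    then have "finite B0"
      using complex_vector.independent_span_bound[OF F(1) B0(2)] B0(1) by blast
    show "V k0 \<subseteq> V k"
    proof
      fix v assume v: "v \<in> V k0"
      show "v \<in> V k"
      proof (rule ccontr)
        assume "v \<notin> V k"
        then have "v \<notin> cspan B" using complex_vector.span_minimal[OF B(1) sub] by blast
        then have "v \<notin> B" and "complex_vector.independent (insert v B)"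
          using complex_vector.span_base complex_vector.independent_insertI[OF _ B(2)] by blast+
        moreover have "insert v B \<subseteq> cspan B0" using v B(1) B0(3) \<open>V k \<subseteq> V k0\<close> by blast
        ultimately have "finite (insert v B) \<and> card (insert v B) \<le> card B0"
          by (intro complex_vector.independent_span_bound[OF \<open>finite B0\<close>])
        then show False using \<open>v \<notin> B\<close> B(4) B0(4) k0[of k] by auto
      qed
    qed
  qed
  then show ?thesis by (rule that)
qed

lemma funpow_bound:
  fixes g :: "'a::real_normed_vector \<Rightarrow> 'a"
  assumes g: "\<And>y. y \<in> K \<Longrightarrow> g y \<in> K \<and> norm (g y) \<le> C * norm y" and y: "y \<in> K" and C: "C \<ge> 0"
  shows "(g ^^ k) y \<in> K \<and> norm ((g ^^ k) y) \<le> C ^ k * norm y"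
proof (induction k)
  case (Suc k)
  have "norm (g ((g ^^ k) y)) \<le> C * norm ((g ^^ k) y)" using Suc g by blast
  also have "\<dots> \<le> C * (C ^ k * norm y)" using Suc C by (intro mult_left_mono) auto
  finally show ?case using Suc g by (simp add: mult.assoc)
qed (use y in simp)

text \<open>Along a backward orbit of exponential growth starting in the kernel of \<open>T - \<alpha>\<close>, the power
  series \<open>\<Sum>k. (\<mu> - \<alpha>)^k x\<^sub>k\<close> is a local solution of \<open>(T - \<mu>) f \<mu> = 0\<close> with \<open>f \<alpha> = x\<^sub>0\<close>.\<close>

lemma SVEP_at_backward_orbit:
  fixes T :: "'a::complex_banach \<Rightarrow> 'a"
  assumes T: "bounded_clinear T" and svep: "SVEP_at T \<alpha>"
    and x0: "shift_op T \<alpha> (x 0) = 0" and xS: "\<And>k. shift_op T \<alpha> (x (Suc k)) = x k"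
    and bound: "\<And>k. norm (x k) \<le> C ^ k * D" and C: "C > 0"
  shows "x 0 = 0"
proof -
  let ?S = "shift_op T \<alpha>" and ?B = "ball \<alpha> (1 / (2 * C))"
  have S: "bounded_clinear ?S" by (rule bounded_clinear_shift_op[OF T])
  obtain f where f: "f vholomorphic_on ?B"
    and sums: "\<And>\<mu>. \<mu> \<in> ?B \<Longrightarrow> (\<lambda>k. (\<mu> - \<alpha>) ^ k *\<^sub>C x k) sums f \<mu>"
    using vholomorphic_power_series[OF bound C] by blast
  have eig: "shift_op T \<mu> (f \<mu>) = 0" if "\<mu> \<in> ?B" for \<mu>
  proof -
    have "(\<lambda>k. ?S ((\<mu> - \<alpha>) ^ k *\<^sub>C x k)) sums ?S (f \<mu>)"
      by (rule bounded_linear.sums[OF bounded_clinear_imp_bounded_linear[OF S] sums[OF that]])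
    moreover have "(\<lambda>k. ?S ((\<mu> - \<alpha>) ^ k *\<^sub>C x k)) sums ((\<mu> - \<alpha>) *\<^sub>C f \<mu>)"
    proof -
      have "(\<lambda>k. (\<mu> - \<alpha>) *\<^sub>C (\<mu> - \<alpha>) ^ k *\<^sub>C x k) sums ((\<mu> - \<alpha>) *\<^sub>C f \<mu>)"
        by (rule bounded_linear.sums[OF bounded_linear_scaleC_right sums[OF that]])
      then have "(\<lambda>k. ?S ((\<mu> - \<alpha>) ^ Suc k *\<^sub>C x (Suc k))) sums ((\<mu> - \<alpha>) *\<^sub>C f \<mu>)"
        by (simp add: bounded_clinear_scaleC[OF S] xS scaleC_scaleC)
      \<comment> \<open>Restores the term \<open>k = 0\<close>, which vanishes because
        \<open>x 0\<close> lies in the kernel.\<close>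
      then show ?thesis
        using sums_Suc_iff[of "\<lambda>k. ?S ((\<mu> - \<alpha>) ^ k *\<^sub>C x k)"] by (simp add: x0 scaleC_one)
    qed
    ultimately have "?S (f \<mu>) = (\<mu> - \<alpha>) *\<^sub>C f \<mu>" by (rule sums_unique2)
    then show ?thesis by (simp add: shift_op_shift_op[of T \<mu> _ \<alpha>])
  qed
  have "\<alpha> \<in> ?B" using C by simp
  then have "f \<alpha> = 0"
    using svep[unfolded SVEP_at_def, rule_format, OF _ vholomorphic_on_imp_vanalytic_on[OF open_ball f] eig] C
    by simp
  moreover have "(\<lambda>k. (\<alpha> - \<alpha>) ^ k *\<^sub>C x k) sums x 0"
    using sums_power_zero_scaleC by simp
  ultimately show ?thesis using sums_unique2[OF sums[OF \<open>\<alpha> \<in> ?B\<close>]] by simp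
qed

text \<open>The kernels inside \<open>R k\<close> stabilise at some \<open>k0\<close>, so the kernel
  in \<open>R k0\<close> lies in the intersection. This stability is what makes \<open>S\<close>
  commute with the intersection: a single preimage in \<open>R k0\<close> then belongs to every
  \<open>R k\<close>.\<close>

lemma decreasing_images_stable_core:
  fixes S :: "'a::complex_normed_vector \<Rightarrow> 'a"
  assumes S: "bounded_clinear S"
    and R_sub: "\<And>k. complex_vector.subspace (R k)" and R_dec: "decseq R"
    and RS: "\<And>k. R (Suc k) = S ` R k" and fin: "cfinite_dim (R 0 \<inter> null_space S)"
  obtains k0 where "R k0 \<inter> null_space S \<subseteq> (\<Inter>k. R k)" "S ` (\<Inter>k. R k) = (\<Inter>k. R k)"
proof -
  note Sl = bounded_clinear_imp_bounded_linear[OF S]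
  define K where "K = (\<Inter>k. R k)"
  have dec: "R l \<subseteq> R k" if "k \<le> l" for k l using R_dec that by (simp add: decseq_def)
  define V where "V k = R k \<inter> null_space S" for k
  obtain k0 where k0: "\<And>k. k \<ge> k0 \<Longrightarrow> V k = V k0"
  proof (rule decreasing_csubspaces_stabilise[of V])
    show "complex_vector.subspace (V k)" for k
      unfolding V_def by (intro complex_vector.subspace_inter R_sub csubspace_null_space[OF S])
    show "decseq V" unfolding decseq_def V_def using dec by blast
    show "cfinite_dim (V 0)" using fin by (simp add: V_def)
  qed auto
  have V_K: "V k0 \<subseteq> K"
  proof
    fix v assume v: "v \<in> V k0"
    have "v \<in> R k" for k
    proof (cases "k \<ge> k0")
      case True
      then show ?thesis using k0[of k] v by (auto simp: V_def)
    next
      case False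
      then show ?thesis using dec[of k k0] v by (auto simp: V_def)
    qed
    then show "v \<in> K" by (simp add: K_def)
  qed
  have "S ` K = K"
  proof
    show "S ` K \<subseteq> K"
    proof
      fix y assume "y \<in> S ` K"
      then have "y \<in> R (Suc k)" for k unfolding RS by (auto simp: K_def)
      then have "y \<in> R k" for k using dec[of k "Suc k"] by auto
      then show "y \<in> K" by (simp add: K_def)
    qed
    show "K \<subseteq> S ` K"
    proof
      fix y assume "y \<in> K"
      then have "y \<in> S ` R k0" using RS[of k0] by (auto simp: K_def)
      then obtain z where z: "z \<in> R k0" "S z = y" by blast
      have "z \<in> R k" if "k \<ge> k0" for k
      proof -
        have "y \<in> S ` R k" using \<open>y \<in> K\<close> RS[of k] by (auto simp: K_def)
        then obtain w where w: "w \<in> R k" "S w = y" by blast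
        \<comment> \<open>Two preimages of \<open>y\<close> differ by a kernel vector of
          \<open>R k0\<close>, hence by an element of \<open>K\<close>, so \<open>z\<close> inherits
          membership in \<open>R k\<close> from \<open>w\<close>.\<close>
        have "z - w \<in> V k0"
          using z w dec[OF that] complex_vector.subspace_diff[OF R_sub]
          by (auto simp: V_def null_space_def linear_simps(2)[OF Sl])
        then have "z - w \<in> R k" using V_K by (auto simp: K_def)
        then show ?thesis using complex_vector.subspace_add[OF R_sub, of "z - w" k w] w(1) by simp
      qed
      moreover have "z \<in> R k" if "k \<le> k0" for k using dec[OF that] z(1) by blast
      ultimately have "z \<in> R k" for k using nat_le_linear by blast
      then show "y \<in> S ` K" using z(2) by (auto simp: K_def)
    qed
  qed
  then show ?thesis using V_K by (intro that[of k0]) (simp_all add: K_def V_def)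
qed

text \<open>Surjectivity on the closed space \<open>K\<close> provides preimages within
  \<open>K\<close> of norm at most \<open>C\<close> times that of the target. Iterating their choice
  \<open>g\<close> from \<open>z\<close> gives a backward orbit of exponential growth.\<close>

lemma SVEP_at_imp_inj_on_core:
  fixes T :: "'a::complex_banach \<Rightarrow> 'a"
  assumes T: "bounded_clinear T" and svep: "SVEP_at T \<alpha>"
    and K: "complex_vector.subspace K" "closed K" "shift_op T \<alpha> ` K = K"
    and z: "z \<in> K" "shift_op T \<alpha> z = 0"
  shows "z = 0"
proof -
  let ?S = "shift_op T \<alpha>"
  have Sl: "bounded_linear ?S"
    by (rule bounded_clinear_imp_bounded_linear[OF bounded_clinear_shift_op[OF T]])
  obtain C where C: "C > 0" "\<And>y. y \<in> ?S ` K \<Longrightarrow> \<exists>x\<in>K. ?S x = y \<and> norm x \<le> C * norm y"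
    by (rule closed_image_bounded_preimage[OF Sl csubspace_imp_subspace[OF K(1)] K(2)])
       (simp_all add: K)
  then obtain g where g: "\<And>y. y \<in> K \<Longrightarrow> g y \<in> K \<and> norm (g y) \<le> C * norm y"
    and Sg: "\<And>y. y \<in> K \<Longrightarrow> ?S (g y) = y"
    unfolding K(3) by metis
  note orbit = funpow_bound[of K g, OF g z(1) less_imp_le[OF C(1)]]
  have "(g ^^ 0) z = 0"
  proof (rule SVEP_at_backward_orbit[OF T svep, where x = "\<lambda>k. (g ^^ k) z"])
    show "?S ((g ^^ Suc k) z) = (g ^^ k) z" for k using Sg orbit by simp
  qed (use z orbit C(1) in auto)
  then show ?thesis by simp
qed

text \<open>Each further range is the image of a closed subspace of \<open>range (S ^^ n)\<close>,
  on which \<open>S\<close> has closed range and finite-dimensional kernel.\<close>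

lemma upper_semi_Fredholm_closed_ranges:
  fixes S :: "'a::complex_banach \<Rightarrow> 'a"
  assumes S: "bounded_clinear S" and clo: "closed (range (S ^^ n))"
    and fred: "upper_semi_Fredholm_on (range (S ^^ n)) S"
  shows "closed (range (S ^^ (n + k)))"
proof (induction k)
  case (Suc k)
  have sub: "complex_vector.subspace (range (S ^^ m))" for m
    by (rule csubspace_image[OF bounded_clinear_funpow[OF S] complex_vector.subspace_UNIV])
  have "closed (S ` range (S ^^ n))" "cfinite_dim (range (S ^^ n) \<inter> null_space S)"
    using fred clo closedin_closed_trans unfolding upper_semi_Fredholm_on_def by blast+
  then have "closed (S ` range (S ^^ (n + k)))"
    by (rule closed_image_of_finite_dim_kernel[OF S sub clo _ _ sub Suc]) (simp add: range_funpow_antimono)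
  then show ?case by (simp add: image_comp comp_def)
qed (use clo in simp)

text \<open>Beyond some exponent \<open>n + k0\<close> the kernel of \<open>S\<close> in the range
  lies in the intersection of all ranges, where SVEP makes it trivial. Thus \<open>n + k0\<close> is
  an index as in \<open>left_Drazin_invertible_iff\<close>.\<close>

lemma upper_semi_B_Fredholm_SVEP_imp_left_Drazin:
  fixes T :: "'a::complex_banach \<Rightarrow> 'a"
  assumes T: "bounded_clinear T" and BF: "upper_semi_B_Fredholm (shift_op T \<alpha>)"
    and svep: "SVEP_at T \<alpha>"
  shows "left_Drazin_invertible (shift_op T \<alpha>)"
proof -
  define S where "S = shift_op T \<alpha>"
  have S: "bounded_clinear S" unfolding S_def by (rule bounded_clinear_shift_op[OF T])
  obtain n where n: "closed (range (S ^^ n))" "upper_semi_Fredholm_on (range (S ^^ n)) S"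
    using BF unfolding S_def upper_semi_B_Fredholm_def by blast
  define R where "R k = range (S ^^ (n + k))" for k
  have R_closed: "closed (R k)" for k
    unfolding R_def by (rule upper_semi_Fredholm_closed_ranges[OF S n])
  have R_sub: "complex_vector.subspace (R k)" for k
    unfolding R_def
    by (rule csubspace_image[OF bounded_clinear_funpow[OF S] complex_vector.subspace_UNIV])
  have "decseq R" by (simp add: decseq_def R_def range_funpow_antimono)
  moreover have "R (Suc k) = S ` R k" for k by (simp add: R_def image_comp comp_def)
  moreover have "cfinite_dim (R 0 \<inter> null_space S)"
    using n(2) by (simp add: R_def upper_semi_Fredholm_on_def)
  ultimately obtain k0 where k0: "R k0 \<inter> null_space S \<subseteq> (\<Inter>k. R k)"
    and core: "S ` (\<Inter>k. R k) = (\<Inter>k. R k)"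
    by (rule decreasing_images_stable_core[OF S R_sub])
  have "complex_vector.subspace (\<Inter>k. R k)"
    by (rule complex_vector.subspace_Inter) (use R_sub in blast)
  moreover have "closed (\<Inter>k. R k)" using R_closed by blast
  ultimately have "\<forall>z\<in>R k0. S z = 0 \<longrightarrow> z = 0"
    using SVEP_at_imp_inj_on_core[OF T svep _ _ core[unfolded S_def]] k0
    by (auto simp: S_def null_space_def)
  moreover have "closed (range (S ^^ Suc (n + k0)))" using R_closed[of "Suc k0"] by (simp add: R_def)
  ultimately have "left_Drazin_invertible S"
    unfolding left_Drazin_invertible_iff[OF bounded_clinear_imp_bounded_linear[OF S]] R_def by blast
  then show ?thesis by (simp add: S_def)
qed

theorem theorem2p1:
  fixes T :: "'a::complex_banach \<Rightarrow> 'a"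
  assumes "bounded_clinear T"
  shows "sigma_lD T = sigma_lBF T \<union> non_SVEP_set T"
proof -
  have "left_Drazin_invertible (shift_op T \<mu>) \<longleftrightarrow>
      upper_semi_B_Fredholm (shift_op T \<mu>) \<and> SVEP_at T \<mu>" for \<mu>
    using assms left_Drazin_invertible_imp_SVEP_at
      left_Drazin_invertible_imp_upper_semi_B_Fredholm[OF
        bounded_clinear_imp_bounded_linear[OF bounded_clinear_shift_op]]
      upper_semi_B_Fredholm_SVEP_imp_left_Drazin by blast
  then show ?thesis by (auto simp: sigma_lD_def sigma_lBF_def non_SVEP_set_def)
qed

end
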